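(* For every integer $n \geq 1$, the number of perfect extremal multi Skolem-type sequences of order $n$ is $n!$.
   Context: A perfect multi Skolem-type sequence of order $n$ is a sequence $(x_1,\dots,x_{2n})$ of positive integers for which the set of positions $\{1,\dots,2n\}$ can be partitioned into $n$ two-element subsets $\{i,j\}$ such that $x_i = x_j = |i-j|$ for each of these subsets. The multiset $A=\{a_1,\dots,a_n\}$ of the $n$ differences, one for each pair, is the multiset from which the sequence is generated. The sequence is called extremal if $\sum_{i=1}^n a_i = n^2$. *)

theory Defs
  imports Main "HOL-Library.Multiset" "HOL-Library.Disjoint_Sets"
begin

text \<open>
  A sequence \<open>(x\<^sub>1, \<dots>, x\<^bsub>2n\<^esub>)\<close> is a list of length \<open>2n\<close>. List positions start at 0, so the
  set of positions is \<open>{..<2n}\<close> rather than \<open>{1..2n}\<close>; only differences of positions matter.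
\<close>

definition skolem_pairing :: "nat \<Rightarrow> nat list \<Rightarrow> nat set set \<Rightarrow> bool" where
  "skolem_pairing n xs P \<longleftrightarrow>
     partition_on {..<2 * n} P \<and> card P = n \<and>
     (\<forall>p\<in>P. \<exists>i j. p = {i, j} \<and> i \<noteq> j \<and>
        int (xs ! i) = \<bar>int i - int j\<bar> \<and> int (xs ! j) = \<bar>int i - int j\<bar>)"

definition perfect_multi_skolem :: "nat \<Rightarrow> nat list \<Rightarrow> bool" where
  "perfect_multi_skolem n xs \<longleftrightarrow>
     length xs = 2 * n \<and> (\<forall>x\<in>set xs. x > 0) \<and> (\<exists>P. skolem_pairing n xs P)"

definition pairing_differences :: "nat set set \<Rightarrow> nat multiset" where
  "pairing_differences P = image_mset (\<lambda>p. Max p - Min p) (mset_set P)"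

definition generated_from :: "nat \<Rightarrow> nat list \<Rightarrow> nat multiset \<Rightarrow> bool" where
  "generated_from n xs A \<longleftrightarrow> (\<exists>P. skolem_pairing n xs P \<and> A = pairing_differences P)"

text \<open>
  The existential quantifier below is harmless: the multiset a sequence is generated from
  is unique, as it contains each value half as often as the sequence does.
\<close>

definition extremal :: "nat \<Rightarrow> nat list \<Rightarrow> bool" where
  "extremal n xs \<longleftrightarrow> (\<exists>A. generated_from n xs A \<and> \<Sum>\<^sub># A = n\<^sup>2)"

end

theory Submission
  imports Defs "HOL-Combinatorics.Permutations"
begin

text \<open>
  The distance between two positions is at most the sum of their distances to the midpoint
  \<open>n - 1/2\<close> of \<open>{0, \<dots>, 2n - 1}\<close>, with equality exactly when they lie in different halves.
  The distances of all positions to the midpoint add up to \<open>n\<^sup>2\<close>, so this is the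
  largest possible sum of differences, and a pairing attains it if and only if each of its blocks
  joins a position \<open>i < n\<close> to a position in the upper half (lemma
  \<open>extremal_pairing_crosses\<close>). Such a pairing is a permutation \<open>\<sigma>\<close> of \<open>{0, \<dots>, n - 1}\<close>, with
  blocks \<open>{i, n + \<sigma> i}\<close>, and it determines the sequence. Conversely the sequence determines
  \<open>\<sigma>\<close>, because its entry at \<open>i < n\<close> is \<open>n + \<sigma> i - i\<close>. The extremal sequences are therefore in
  bijection with the \<open>n!\<close> permutations.
\<close>

section \<open>Distances to the midpoint\<close>

text \<open>Twice the distance to the midpoint, in order to stay within the integers.\<close>

definition mid_dist :: "nat \<Rightarrow> nat \<Rightarrow> int" where
  "mid_dist n i = \<bar>2 * int i + 1 - 2 * int n\<bar>"

lemma sum_mid_dist: "(\<Sum>i<2 * n. mid_dist n i) = 2 * int n ^ 2"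
proof -
  have lower: "(\<Sum>i<n. mid_dist n i) = (\<Sum>i<n. 2 * int n - 1 - 2 * int i)"
    by (rule sum.cong) (auto simp: mid_dist_def)
  have upper: "(\<Sum>i<n. mid_dist n (n + i)) = (\<Sum>i<n. 2 * int i + 1)"
    by (rule sum.cong) (auto simp: mid_dist_def)
  have split: "{..<2 * n} = {..<n} \<union> (+) n ` {..<n}"
  proof (rule set_eqI)
    fix i show "i \<in> {..<2 * n} \<longleftrightarrow> i \<in> {..<n} \<union> (+) n ` {..<n}"
      by (cases "i < n") (auto intro: image_eqI[of _ _ "i - n"])
  qed
  have "(\<Sum>i<2 * n. mid_dist n i)
      = (\<Sum>i<n. mid_dist n i) + sum (mid_dist n) ((+) n ` {..<n})"
    unfolding split by (rule sum.union_disjoint) auto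
  also have "sum (mid_dist n) ((+) n ` {..<n}) = (\<Sum>i<n. mid_dist n (n + i))"
    by (subst sum.reindex) auto
  \<comment> \<open>The terms for \<open>i\<close> and \<open>n + i\<close> add up to \<open>2n\<close>.\<close>
  also have "(\<Sum>i<n. mid_dist n i) + \<dots> = (\<Sum>i<n. 2 * int n)"
    unfolding lower upper sum.distrib[symmetric] by (rule sum.cong) auto
  finally show ?thesis by (simp add: power2_eq_square)
qed

lemma dist_le_mid_dist:
  assumes "i < j"
  shows "2 * (int j - int i) \<le> mid_dist n i + mid_dist n j"
  using assms by (auto simp: mid_dist_def abs_if split: if_splits)

lemma dist_eq_mid_dist_imp_crosses:
  assumes "i < j" "2 * (int j - int i) = mid_dist n i + mid_dist n j"
  shows "i < n \<and> n \<le> j"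
proof
  show "i < n" using assms by (auto simp: mid_dist_def abs_if split: if_splits)
  show "n \<le> j" using assms by (auto simp: mid_dist_def abs_if split: if_splits)
qed

section \<open>Pairings of maximal total difference\<close>

lemma skolem_pairing_block:
  assumes "skolem_pairing n xs P" "p \<in> P"
  obtains i j where "p = {i, j}" "i < j" "j < 2 * n" "xs ! i = j - i" "xs ! j = j - i"
proof -
  obtain a b where ab: "p = {a, b}" "a \<noteq> b"
    "int (xs ! a) = \<bar>int a - int b\<bar>" "int (xs ! b) = \<bar>int a - int b\<bar>"
    using assms unfolding skolem_pairing_def by metis
  have "p \<subseteq> {..<2 * n}"
    using assms unfolding skolem_pairing_def partition_on_def by auto
  then have "a < 2 * n" "b < 2 * n" using ab by auto
  moreover have "p = {min a b, max a b}" using ab(1) by (auto simp: min_def max_def)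
  ultimately show thesis
    using that[of "min a b" "max a b"] ab(2-) by (cases "a < b") (auto simp: min_def max_def)
qed

text \<open>
  Summed over the blocks, the bound of the difference by the distances to the midpoint
  becomes an equality, so it is an equality for every single block.
\<close>

lemma extremal_pairing_crosses:
  assumes P: "skolem_pairing n xs P" and total: "\<Sum>\<^sub># (pairing_differences P) = n\<^sup>2"
    and p: "p \<in> P"
  obtains i j where "p = {i, j}" "i < n" "n \<le> j" "j < 2 * n" "xs ! i = j - i" "xs ! j = j - i"
proof -
  have part: "partition_on {..<2 * n} P"
    using P unfolding skolem_pairing_def by blast
  have fin: "finite P" using finite_elements[OF _ part] by simp
  have fin_block: "\<forall>q\<in>P. finite q" using P by (blast elim: skolem_pairing_block)
  let ?d = "\<lambda>q. 2 * int (Max q - Min q)"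
  have le: "?d q \<le> sum (mid_dist n) q" if "q \<in> P" for q
  proof -
    obtain i j where "q = {i, j}" "i < j" using skolem_pairing_block[OF P \<open>q \<in> P\<close>] by metis
    then show ?thesis using dist_le_mid_dist[of i j n] by simp
  qed
  have "(\<Sum>q\<in>P. Max q - Min q) = n\<^sup>2"
    using total by (simp add: pairing_differences_def sum_unfold_sum_mset)
  then have "sum ?d P = 2 * int n ^ 2"
    by (metis of_nat_power of_nat_sum sum_distrib_left)
  also have "\<dots> = sum (mid_dist n) (\<Union>P)"
    using part sum_mid_dist by (simp add: partition_on_def)
  also have "\<dots> = (\<Sum>q\<in>P. sum (mid_dist n) q)"
    using part fin_block
    by (subst sum.Union_disjoint) (auto simp: partition_on_def disjoint_def)
  finally have eq: "?d p = sum (mid_dist n) p"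
    using sum_mono_inv[of ?d P "sum (mid_dist n)"] le p fin by blast
  obtain i j where ij: "p = {i, j}" "i < j" "j < 2 * n" "xs ! i = j - i" "xs ! j = j - i"
    using skolem_pairing_block[OF P p] by metis
  then have "2 * (int j - int i) = mid_dist n i + mid_dist n j"
    using eq by simp
  then show thesis using dist_eq_mid_dist_imp_crosses[OF ij(2)] that ij by metis
qed

section \<open>Extremal sequences and permutations\<close>

definition perm_seq :: "nat \<Rightarrow> (nat \<Rightarrow> nat) \<Rightarrow> nat list" where
  "perm_seq n \<sigma> = map (\<lambda>i. if i < n then n + \<sigma> i - i else i - inv \<sigma> (i - n)) [0..<2 * n]"

definition perm_pairing :: "nat \<Rightarrow> (nat \<Rightarrow> nat) \<Rightarrow> nat set set" where
  "perm_pairing n \<sigma> = (\<lambda>i. {i, n + \<sigma> i}) ` {..<n}"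

lemma length_perm_seq [simp]: "length (perm_seq n \<sigma>) = 2 * n"
  by (simp add: perm_seq_def)

lemma perm_seq_lower: "i < n \<Longrightarrow> perm_seq n \<sigma> ! i = n + \<sigma> i - i"
  by (simp add: perm_seq_def)

lemma perm_seq_upper:
  assumes "\<sigma> permutes {..<n}" "i < n"
  shows "perm_seq n \<sigma> ! (n + \<sigma> i) = n + \<sigma> i - i"
proof -
  have "\<sigma> i < n" using assms permutes_in_image by fastforce
  moreover have "inv \<sigma> (\<sigma> i) = i" using assms(1) by (rule permutes_inverses)
  ultimately show ?thesis by (simp add: perm_seq_def)
qed

lemma upper_half_image:
  fixes j :: nat
  assumes "\<sigma> permutes {..<n}" "n \<le> j" "j < 2 * n"
  shows "\<exists>i<n. j = n + \<sigma> i"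
proof -
  have "j - n \<in> \<sigma> ` {..<n}" using assms by (auto simp: permutes_image)
  then obtain i where "i < n" "j - n = \<sigma> i" by auto
  then show ?thesis using assms(2) by (intro exI[of _ i]) simp
qed

lemma inj_on_block:
  fixes n :: nat
  shows "inj_on (\<lambda>i. {i, n + \<sigma> i}) {..<n}"
proof (rule inj_onI)
  fix i j assume ij: "i \<in> {..<n}" "j \<in> {..<n}" "{i, n + \<sigma> i} = {j, n + \<sigma> j}"
  then have "i = j \<or> i = n + \<sigma> j" by blast
  then show "i = j" using ij(1) by auto
qed

lemma skolem_pairing_perm:
  assumes perm: "\<sigma> permutes {..<n}"
  shows "skolem_pairing n (perm_seq n \<sigma>) (perm_pairing n \<sigma>)"
proof -
  have lt: "\<sigma> i < n" if "i < n" for i using that perm permutes_in_image by fastforce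
  have inj: "i = j" if "\<sigma> i = \<sigma> j" for i j using that permutes_inj[OF perm] by (simp add: inj_eq)
  have "\<Union> (perm_pairing n \<sigma>) = {..<2 * n}"
  proof (intro set_eqI iffI)
    fix j assume "j \<in> {..<2 * n}"
    then show "j \<in> \<Union> (perm_pairing n \<sigma>)"
      unfolding perm_pairing_def
      by (cases "j < n") (auto simp: not_less dest: upper_half_image[OF perm])
  qed (auto simp: perm_pairing_def dest: lt)
  moreover have "disjoint (perm_pairing n \<sigma>)"
    unfolding disjoint_def perm_pairing_def by (auto dest: inj)
  moreover have "{} \<notin> perm_pairing n \<sigma>" by (auto simp: perm_pairing_def)
  moreover have "card (perm_pairing n \<sigma>) = n"
    unfolding perm_pairing_def using card_image[OF inj_on_block] by simp
  moreover have "\<exists>i j. p = {i, j} \<and> i \<noteq> j \<and> int (perm_seq n \<sigma> ! i) = \<bar>int i - int j\<bar>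
      \<and> int (perm_seq n \<sigma> ! j) = \<bar>int i - int j\<bar>" if p: "p \<in> perm_pairing n \<sigma>" for p
  proof -
    obtain i where "i < n" "p = {i, n + \<sigma> i}" using p by (auto simp: perm_pairing_def)
    then show ?thesis
      by (intro exI[of _ i] exI[of _ "n + \<sigma> i"])
        (auto simp: perm_seq_lower perm_seq_upper[OF perm])
  qed
  ultimately show ?thesis
    unfolding skolem_pairing_def partition_on_def by blast
qed

text \<open>
  The total difference is \<open>(\<Sum>i<n. n + \<sigma> i - i)\<close>, and \<open>\<sigma>\<close> only rearranges the indices.
\<close>

lemma sum_differences_perm_pairing:
  assumes perm: "\<sigma> permutes {..<n}"
  shows "\<Sum>\<^sub># (pairing_differences (perm_pairing n \<sigma>)) = n\<^sup>2"
proof -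
  have "\<Sum>\<^sub># (pairing_differences (perm_pairing n \<sigma>))
      = (\<Sum>p\<in>perm_pairing n \<sigma>. Max p - Min p)"
    by (simp add: pairing_differences_def sum_unfold_sum_mset)
  also have "\<dots> = (\<Sum>i<n. n + \<sigma> i - i)"
    unfolding perm_pairing_def by (subst sum.reindex[OF inj_on_block]) auto
  finally have "\<Sum>\<^sub># (pairing_differences (perm_pairing n \<sigma>)) + (\<Sum>i<n. i)
      = (\<Sum>i<n. n + \<sigma> i - i) + (\<Sum>i<n. i)" by simp
  also have "\<dots> = (\<Sum>i<n. n + \<sigma> i)"
    unfolding sum.distrib[symmetric] by (rule sum.cong) auto
  also have "\<dots> = n\<^sup>2 + (\<Sum>i<n. i)"
    using sum.permute[OF perm, of "\<lambda>i. i"] by (simp add: sum.distrib power2_eq_square comp_def)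
  finally show ?thesis by simp
qed

lemma perm_seq_extremal:
  assumes perm: "\<sigma> permutes {..<n}"
  shows "perfect_multi_skolem n (perm_seq n \<sigma>) \<and> extremal n (perm_seq n \<sigma>)"
proof -
  have "0 < perm_seq n \<sigma> ! j" if "j < 2 * n" for j
  proof (cases "j < n")
    case True
    then show ?thesis by (simp add: perm_seq_lower)
  next
    case False
    then obtain i where "i < n" "j = n + \<sigma> i"
      using upper_half_image[OF perm _ \<open>j < 2 * n\<close>] not_less by blast
    then show ?thesis using perm_seq_upper[OF perm] by simp
  qed
  then have "\<forall>x\<in>set (perm_seq n \<sigma>). 0 < x" by (auto simp: in_set_conv_nth)
  then show ?thesis
    unfolding perfect_multi_skolem_def extremal_def generated_from_def
    using skolem_pairing_perm[OF perm] sum_differences_perm_pairing[OF perm] by auto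
qed

text \<open>
  The partner of \<open>i < n\<close> is \<open>i + xs ! i\<close>, in the upper half. Distinct positions have distinct
  partners because blocks are disjoint, so the partner map is a permutation up to the shift by \<open>n\<close>.
\<close>

lemma extremal_is_perm_seq:
  assumes len: "length xs = 2 * n" and P: "skolem_pairing n xs P"
    and total: "\<Sum>\<^sub># (pairing_differences P) = n\<^sup>2"
  obtains \<sigma> where "\<sigma> permutes {..<n}" "xs = perm_seq n \<sigma>"
proof -
  define \<sigma> where "\<sigma> i = (if i < n then i + xs ! i - n else i)" for i
  have part: "\<Union>P = {..<2 * n}" "disjoint P"
    using P unfolding skolem_pairing_def partition_on_def by auto
  have lower: "{i, n + \<sigma> i} \<in> P \<and> \<sigma> i < n \<and> xs ! i = n + \<sigma> i - i" if i: "i < n" for i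
  proof -
    have "i \<in> \<Union>P" using i part by simp
    then obtain p where p: "p \<in> P" "i \<in> p" by blast
    obtain a b where ab: "p = {a, b}" "a < n" "n \<le> b" "b < 2 * n" "xs ! a = b - a"
      using extremal_pairing_crosses[OF P total p(1)] by metis
    then have "a = i" using p(2) i by auto
    then show ?thesis using ab p(1) by (simp add: \<sigma>_def)
  qed
  have "inj_on \<sigma> {..<n}"
  proof (rule inj_onI)
    fix i j assume ij: "i \<in> {..<n}" "j \<in> {..<n}" "\<sigma> i = \<sigma> j"
    have "n + \<sigma> i \<in> {i, n + \<sigma> i} \<inter> {j, n + \<sigma> j}" using ij(3) by simp
    then have "{i, n + \<sigma> i} = {j, n + \<sigma> j}"
      using ij(1,2) lower[of i] lower[of j] disjointD[OF part(2)] by auto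
    then show "i = j" using ij by (simp add: doubleton_eq_iff)
  qed
  moreover have "\<sigma> ` {..<n} \<subseteq> {..<n}" using lower by auto
  ultimately have "bij_betw \<sigma> {..<n} {..<n}"
    by (simp add: bij_betw_def endo_inj_surj)
  then have perm: "\<sigma> permutes {..<n}"
    by (rule bij_imp_permutes) (simp add: \<sigma>_def)
  have "xs = perm_seq n \<sigma>"
  proof (rule nth_equalityI)
    fix j assume "j < length xs"
    then have j: "j < 2 * n" using len by simp
    show "xs ! j = perm_seq n \<sigma> ! j"
    proof (cases "j < n")
      case True
      then show ?thesis using lower by (simp add: perm_seq_lower)
    next
      case False
      then obtain i where i: "i < n" "j = n + \<sigma> i"
        using upper_half_image[OF perm _ j] not_less by blast
      obtain a b where ab: "{i, j} = {a, b}" "a < n" "n \<le> b" "xs ! b = b - a"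
        using extremal_pairing_crosses[OF P total] lower[OF i(1)] i(2) by metis
      then have "a = i" "b = j" using i by (auto simp: doubleton_eq_iff)
      then show ?thesis using ab perm_seq_upper[OF perm i(1)] i(2) by simp
    qed
  qed (simp add: len)
  with perm show thesis by (rule that)
qed

lemma inj_on_perm_seq: "inj_on (perm_seq n) {\<sigma>. \<sigma> permutes {..<n}}"
proof (rule inj_onI)
  fix \<sigma> \<tau>
  assume "\<sigma> \<in> {\<sigma>. \<sigma> permutes {..<n}}" "\<tau> \<in> {\<sigma>. \<sigma> permutes {..<n}}"
    and eq: "perm_seq n \<sigma> = perm_seq n \<tau>"
  then have perm: "\<sigma> permutes {..<n}" "\<tau> permutes {..<n}" by auto
  show "\<sigma> = \<tau>"
  proof
    fix i show "\<sigma> i = \<tau> i"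
    proof (cases "i < n")
      case True
      then have "n + \<sigma> i - i = n + \<tau> i - i" using eq by (metis perm_seq_lower)
      then show ?thesis using True by simp
    next
      case False
      then show ?thesis using perm by (simp add: permutes_not_in)
    qed
  qed
qed

theorem theorem12:
  fixes n :: nat
  assumes "n \<ge> 1"
  shows "card {xs :: nat list. perfect_multi_skolem n xs \<and> extremal n xs} = fact n"
proof -
  have "{xs. perfect_multi_skolem n xs \<and> extremal n xs} = perm_seq n ` {\<sigma>. \<sigma> permutes {..<n}}"
  proof (intro set_eqI iffI)
    fix xs assume "xs \<in> {xs. perfect_multi_skolem n xs \<and> extremal n xs}"
    then obtain P where "length xs = 2 * n" "skolem_pairing n xs P"
      "\<Sum>\<^sub># (pairing_differences P) = n\<^sup>2"
      unfolding perfect_multi_skolem_def extremal_def generated_from_def by auto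
    then show "xs \<in> perm_seq n ` {\<sigma>. \<sigma> permutes {..<n}}"
      using extremal_is_perm_seq by blast
  qed (auto simp: perm_seq_extremal)
  then show ?thesis
    using card_image[OF inj_on_perm_seq] card_permutations[of "{..<n}" n] by simp
qed

end
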